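(* Let $G$ be a tree, let $c,d\in V(G)$, and let $\bowtie$ be a non-trivial balanced equivalence relation on $V(G)$. If $c\bowtie d$, then $L_c=L_d$ as multisets.
   Context: Graphs are finite and simple (undirected, no multiple edges, no loops). A tree is a connected graph without cycles; a leaf is a vertex of degree one. An equivalence relation $\bowtie$ on $V(G)$ is balanced if, whenever $c\bowtie d$, there is a bijection $\beta$ from the set of neighbors of $c$ to the set of neighbors of $d$ with $v\bowtie\beta(v)$ for every neighbor $v$ of $c$. It is trivial if every class is a singleton, and non-trivial otherwise. $\operatorname{dist}$ denotes graph distance. For $c\in V(G)$, $L_c$ is the multiset $\{\operatorname{dist}(c,l): l \text{ is a leaf of } G\}$ (one entry for each leaf, counted with multiplicity). *)

theory Defs
  imports "Graph_Theory.Graph_Theory" "HOL-Library.Multiset"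
begin

text \<open>
  A finite simple graph is a \<^locale>\<open>pair_graph\<close>: an undirected edge between \<open>u\<close> and \<open>v\<close> is
  the pair of opposite arcs \<open>(u, v)\<close> and \<open>(v, u)\<close>.  The library predicates \<open>forest\<close> and
  \<open>tree\<close> are unsuitable for such graphs, because they count the closed walk \<open>u, v, u\<close> along
  a single edge as a cycle.  In a simple graph, the undirected cycles are the library cycles
  with at least three arcs.
\<close>

definition undirected_cycle :: "'a pair_pre_digraph \<Rightarrow> ('a \<times> 'a) awalk \<Rightarrow> bool" where
  "undirected_cycle G p \<longleftrightarrow> pre_digraph.cycle (with_proj G) p \<and> length p \<ge> 3"

locale undirected_tree = pair_graph G for G :: "'a pair_pre_digraph" +
  assumes connected_tree: "Digraph_Component.connected (with_proj G)"
    and acyclic_tree: "\<nexists>p. undirected_cycle G p"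

definition neighbors :: "'a pair_pre_digraph \<Rightarrow> 'a \<Rightarrow> 'a set" where
  "neighbors G v = {w. (v, w) \<in> parcs G}"

text \<open>
  The degree of a vertex is its out-degree, since each undirected edge at \<open>v\<close> contributes
  exactly one arc with tail \<open>v\<close>.
\<close>

definition leaves :: "'a pair_pre_digraph \<Rightarrow> 'a set" where
  "leaves G = {v \<in> pverts G. out_degree (with_proj G) v = 1}"

text \<open>
  The least length of a walk from \<open>u\<close> to \<open>v\<close>; the value is unspecified if there is no such
  walk, which cannot happen for vertices of a connected graph.
\<close>

definition graph_dist :: "'a pair_pre_digraph \<Rightarrow> 'a \<Rightarrow> 'a \<Rightarrow> nat" where
  "graph_dist G u v = (LEAST n. \<exists>p. pre_digraph.awalk (with_proj G) u p v \<and> length p = n)"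

definition balanced :: "'a pair_pre_digraph \<Rightarrow> 'a rel \<Rightarrow> bool" where
  "balanced G R \<longleftrightarrow> (\<forall>(c, d) \<in> R. \<exists>\<beta>. bij_betw \<beta> (neighbors G c) (neighbors G d) \<and>
     (\<forall>v \<in> neighbors G c. (v, \<beta> v) \<in> R))"

definition trivial_equiv :: "'a pair_pre_digraph \<Rightarrow> 'a rel \<Rightarrow> bool" where
  "trivial_equiv G R \<longleftrightarrow> (\<forall>X \<in> pverts G // R. is_singleton X)"

definition leaf_dists :: "'a pair_pre_digraph \<Rightarrow> 'a \<Rightarrow> nat multiset" where
  "leaf_dists G c = image_mset (graph_dist G c) (mset_set (leaves G))"

end

theory Submission
  imports Defs
begin

text \<open>
  Let \<open>N n v\<close> be the number of leaves at distance \<open>n\<close> from \<open>v\<close>.  In a tree, a leaf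
  \<open>l \<noteq> v\<close> is one step closer to exactly one neighbour of \<open>v\<close> and one step further from all
  the others.  Hence the sum of \<open>N n w\<close> over the neighbours \<open>w\<close> of \<open>v\<close> is
  \<open>N (n + 1) v + (deg v - 1) * N (n - 1) v\<close> for \<open>n \<ge> 2\<close>, with similar formulas for
  \<open>n = 0\<close> and \<open>n = 1\<close>.  Degrees and neighbour sums of class functions are preserved by a
  balanced relation, so this recursion shows by induction on \<open>n\<close> that \<open>N n\<close> is a class
  function.
\<close>

context pair_graph
begin

section \<open>Neighbourhoods, degrees and walk lengths\<close>

lemma in_neighbors_iff: "w \<in> neighbors G v \<longleftrightarrow> (v, w) \<in> parcs G"
  by (simp add: neighbors_def)

lemma neighbors_subset: "neighbors G v \<subseteq> pverts G"
  by (auto simp: neighbors_def dest: in_arcsD2)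

lemma finite_neighbors: "finite (neighbors G v)"
  using neighbors_subset pair_finite_verts by (rule finite_subset)

lemma out_degree_eq_card_neighbors: "out_degree (with_proj G) v = card (neighbors G v)"
proof -
  have "out_arcs (with_proj G) v = Pair v ` neighbors G v"
    by (auto simp: out_arcs_def neighbors_def)
  then show ?thesis
    by (simp add: out_degree_def card_image inj_on_def)
qed

lemma graph_dist_le:
  assumes "awalk u p v"
  shows "graph_dist G u v \<le> length p"
  unfolding graph_dist_def using assms by (intro Least_le) blast

end

context undirected_tree
begin

section \<open>Distances in a tree\<close>

lemma shortest_awalk:
  assumes "u \<in> pverts G" "v \<in> pverts G"
  obtains p where "awalk u p v" "length p = graph_dist G u v"
proof -
  \<comment> \<open>Connectedness disregards arc directions; since arcs come in opposite pairs, it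
    yields directed walks, so the \<open>LEAST\<close> in \<open>graph_dist\<close> is
    attained.\<close>
  have "strongly_connected (with_proj G)"
    using symmetric_connected_imp_strongly_connected connected_tree pair_sym_arcs by blast
  then have "u \<rightarrow>\<^sup>*\<^bsub>with_proj G\<^esub> v"
    using assms by auto
  then have "\<exists>n p. awalk u p v \<and> length p = n"
    using reachable_awalk by blast
  then have "\<exists>p. awalk u p v \<and> length p = graph_dist G u v"
    unfolding graph_dist_def by (rule LeastI_ex)
  then show thesis
    using that by blast
qed

lemma graph_dist_eq_0_iff:
  assumes "u \<in> pverts G" "v \<in> pverts G"
  shows "graph_dist G u v = 0 \<longleftrightarrow> u = v"
proof
  assume "graph_dist G u v = 0"
  then show "u = v"
    using shortest_awalk[OF assms] by (metis awalk_Nil_iff length_0_conv)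
next
  assume "u = v"
  then show "graph_dist G u v = 0"
    using graph_dist_le[of u "[]" v] assms by (simp add: awalk_Nil_iff)
qed

lemma graph_dist_neighbor_le:
  assumes "(v, w) \<in> parcs G" "l \<in> pverts G"
  shows "graph_dist G v l \<le> Suc (graph_dist G w l)"
proof -
  obtain p where p: "awalk w p l" "length p = graph_dist G w l"
    using shortest_awalk assms in_arcsD2 by blast
  have "awalk v ((v, w) # p) l"
    using p assms by (auto simp: awalk_Cons_iff)
  from graph_dist_le[OF this] show ?thesis
    using p by simp
qed

lemma closer_neighbor:
  assumes "v \<in> pverts G" "l \<in> pverts G" "v \<noteq> l"
  obtains w where "(v, w) \<in> parcs G" "Suc (graph_dist G w l) = graph_dist G v l"
proof -
  obtain p where p: "awalk v p l" "length p = graph_dist G v l"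
    using shortest_awalk assms by blast
  obtain w q where q: "p = (v, w) # q" "(v, w) \<in> parcs G" "awalk w q l"
    using p(1) assms(3) by (cases p) (auto simp: awalk_Nil_iff awalk_Cons_iff)
  have "graph_dist G w l \<le> length q"
    using graph_dist_le q by blast
  moreover have "graph_dist G v l \<le> Suc (graph_dist G w l)"
    using graph_dist_neighbor_le q assms by blast
  ultimately show thesis
    using that q p by fastforce
qed

section \<open>Uniqueness of the neighbour closer to a given vertex\<close>

text \<open>Otherwise the walk, shortened to a path and closed up through \<open>v\<close>, would be
  an undirected cycle.\<close>

lemma awalk_between_neighbors_meets:
  assumes v: "(v, w) \<in> parcs G" "(v, w') \<in> parcs G" "w \<noteq> w'"
    and p: "awalk w p w'"
  shows "v \<in> set (awalk_verts w p)"
proof (rule ccontr)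
  assume nin: "v \<notin> set (awalk_verts w p)"
  define q where "q = awalk_to_apath p"
  have q: "awalk w q w'" "distinct (awalk_verts w q)"
    using apath_awalk_to_apath[OF p] by (auto simp: q_def apath_def)
  have "set q \<subseteq> set p"
    using awalk_to_apath_subset[OF p] by (simp add: q_def)
  then have vq: "v \<notin> set (awalk_verts w q)"
    using nin set_awalk_verts[OF p] set_awalk_verts[OF q(1)] by auto
  have "q \<noteq> []"
    using q v by (auto simp: awalk_Nil_iff)
  define r where "r = (v, w) # q @ [(w', v)]"
  have "awalk w' [(w', v)] v"
    using arcs_symmetric[OF v(2)] by (auto simp: awalk_simps dest: in_arcsD1 in_arcsD2)
  then have wk: "awalk w (q @ [(w', v)]) v"
    using q by auto
  then have "awalk v r v"
    using v by (auto simp: r_def awalk_Cons_iff)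
  moreover have "awalk_verts w (q @ [(w', v)]) = awalk_verts w q @ [v]"
    using awalk_verts_append[OF wk] q by simp
  then have "distinct (tl (awalk_verts v r))"
    using q vq by (simp add: r_def)
  ultimately have "cycle r"
    unfolding cycle_def by (auto simp: r_def)
  \<comment> \<open>Since \<open>w\<close> and \<open>w'\<close> differ, \<open>q\<close> has an
    arc; the two arcs at \<open>v\<close> bring the total to three, so \<open>r\<close> is not a
    mere back-and-forth along one edge.\<close>
  moreover have "length r \<ge> 3"
    using \<open>q \<noteq> []\<close> by (cases q) (auto simp: r_def)
  ultimately show False
    using acyclic_tree by (auto simp: undirected_cycle_def)
qed

text \<open>A shortest walk serves: if it met \<open>v\<close>, its remainder from \<open>v\<close>
  on would reach \<open>l\<close> in fewer than \<open>graph_dist G w l\<close> steps, hence in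
  fewer than \<open>graph_dist G v l\<close>.\<close>

lemma awalk_avoiding:
  assumes "(v, w) \<in> parcs G" "l \<in> pverts G" "graph_dist G w l \<le> graph_dist G v l"
  obtains p where "awalk w p l" "v \<notin> set (awalk_verts w p)"
proof -
  obtain p where p: "awalk w p l" "length p = graph_dist G w l"
    using shortest_awalk assms in_arcsD2 by blast
  have "v \<notin> set (awalk_verts w p)"
  proof
    assume "v \<in> set (awalk_verts w p)"
    then obtain q r where qr: "p = q @ r" "awalk w q v" "awalk v r l"
      using awalk_decomp[OF p(1)] by blast
    have "w \<noteq> v"
      using assms(1) no_loops' by blast
    then have "q \<noteq> []"
      using qr by (auto simp: awalk_Nil_iff)
    then have "length r < length p"
      using qr by simp
    then show False
      using graph_dist_le[OF qr(3)] p assms by simp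
  qed
  then show thesis
    using that p by blast
qed

text \<open>Otherwise, going from \<open>w\<close> to \<open>l\<close> and back to \<open>w'\<close>
  along walks avoiding \<open>v\<close> would join two distinct neighbours of \<open>v\<close>
  without meeting \<open>v\<close>. Because the bounds are not strict, ties are excluded too: all
  neighbours but the closer one are strictly farther from \<open>l\<close> than \<open>v\<close>
  is.\<close>

lemma closer_neighbor_unique:
  assumes "(v, w) \<in> parcs G" "(v, w') \<in> parcs G" "l \<in> pverts G"
    and "graph_dist G w l \<le> graph_dist G v l" "graph_dist G w' l \<le> graph_dist G v l"
  shows "w = w'"
proof (rule ccontr)
  assume "w \<noteq> w'"
  obtain p where p: "awalk w p l" "v \<notin> set (awalk_verts w p)"
    using awalk_avoiding assms by blast
  obtain q where q: "awalk w' q l" "v \<notin> set (awalk_verts w' q)"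
    using awalk_avoiding assms by blast
  have rq: "awalk l (rev_path q) w'"
    using q awalk_rev_path by blast
  then have wk: "awalk w (p @ rev_path q) w'"
    using p by auto
  have "set (awalk_verts w (p @ rev_path q)) = set (awalk_verts w p) \<union> set (awalk_verts l (rev_path q))"
    using set_awalk_verts_append[OF p(1) rq] .
  then have "v \<notin> set (awalk_verts w (p @ rev_path q))"
    using p q awalk_verts_rev_path[OF q(1)] by auto
  then show False
    using awalk_between_neighbors_meets[OF assms(1,2) \<open>w \<noteq> w'\<close> wk] by blast
qed

section \<open>Counting by distance\<close>

text \<open>One neighbour leads towards \<open>l\<close> and the others away from it, unless
  \<open>l\<close> is \<open>v\<close> itself: then all neighbours are at distance 1, whence the
  exceptional value \<open>n = 1\<close>.\<close>

lemma card_neighbors_at_dist: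
  assumes v: "v \<in> pverts G" and l: "l \<in> pverts G"
  shows "card {w \<in> neighbors G v. graph_dist G w l = n} =
    (if graph_dist G v l = Suc n then 1 else 0) +
    (if Suc (graph_dist G v l) = n
     then (if n = 1 then card (neighbors G v) else card (neighbors G v) - 1) else 0)"
proof (cases "v = l")
  case True
  have "graph_dist G w l = 1" if "w \<in> neighbors G v" for w
  proof -
    have w: "(w, v) \<in> parcs G" "w \<in> pverts G" "w \<noteq> v"
      using that arcs_symmetric no_loops' in_arcsD2 by (auto simp: in_neighbors_iff)
    then have "graph_dist G w l \<le> Suc (graph_dist G v l)"
      using graph_dist_neighbor_le l by blast
    moreover have "graph_dist G v l = 0" "graph_dist G w l \<noteq> 0"
      using w True v graph_dist_eq_0_iff by auto
    ultimately show ?thesis by simp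
  qed
  then have "{w \<in> neighbors G v. graph_dist G w l = n} = (if n = 1 then neighbors G v else {})"
    by auto
  moreover have "graph_dist G v l = 0"
    using True v graph_dist_eq_0_iff[of v v] by simp
  ultimately show ?thesis by auto
next
  case False
  define m where "m = graph_dist G v l"
  have m: "m \<noteq> 0"
    using False v l graph_dist_eq_0_iff by (simp add: m_def)
  obtain u where u: "(v, u) \<in> parcs G" "Suc (graph_dist G u l) = m"
    using closer_neighbor v l False unfolding m_def by blast
  have far: "graph_dist G w l = Suc m" if "w \<in> neighbors G v" "w \<noteq> u" for w
  proof -
    have w: "(v, w) \<in> parcs G" "(w, v) \<in> parcs G"
      using that arcs_symmetric by (auto simp: in_neighbors_iff)
    have "graph_dist G w l \<le> Suc m"
      using graph_dist_neighbor_le w l unfolding m_def by blast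
    moreover have "\<not> graph_dist G w l \<le> m"
      using closer_neighbor_unique[OF w(1) u(1) l] that u unfolding m_def by auto
    ultimately show ?thesis by simp
  qed
  then have dist: "graph_dist G w l = (if w = u then m - 1 else Suc m)" if "w \<in> neighbors G v" for w
    using that u(2) by auto
  have "u \<in> neighbors G v"
    using u(1) by (simp add: in_neighbors_iff)
  have "{w \<in> neighbors G v. graph_dist G w l = n} =
      {w \<in> neighbors G v. (if w = u then m - 1 else Suc m) = n}"
    by (intro Collect_cong conj_cong refl, subst dist) simp_all
  \<comment> \<open>As \<open>m\<close> is not 0, \<open>m - 1 = n\<close> means
    \<open>m = Suc n\<close> despite truncated subtraction; for the same reason
    \<open>Suc m = n\<close> never meets the exceptional value \<open>n = 1\<close> below.\<close>
  also have "\<dots> = (if m = Suc n then {u} else if Suc m = n then neighbors G v - {u} else {})"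
    using m \<open>u \<in> neighbors G v\<close> by auto
  finally show ?thesis
    using m \<open>u \<in> neighbors G v\<close> by (auto simp: m_def[symmetric] card_Diff_singleton)
qed

text \<open>Double counting of the pairs of a neighbour \<open>w\<close> and an \<open>l\<close> in
  \<open>L\<close> at distance \<open>n\<close>. Solved for its first summand, this is the recursion
  for the counts at \<open>v\<close>.\<close>

lemma sum_neighbors_card_at_dist:
  assumes v: "v \<in> pverts G" and L: "L \<subseteq> pverts G"
  shows "(\<Sum>w\<in>neighbors G v. card {l \<in> L. graph_dist G w l = n}) =
    card {l \<in> L. graph_dist G v l = Suc n} +
    (if n = 1 then card (neighbors G v) else card (neighbors G v) - 1) *
      card {l \<in> L. Suc (graph_dist G v l) = n}"
    (is "_ = _ + ?k * _")
proof -
  have fin: "finite L"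
    using L pair_finite_verts by (rule finite_subset)
  have count: "card {x \<in> A. P x} = (\<Sum>x\<in>A. if P x then 1 else 0)"
    if "finite A" for A :: "'a set" and P
    using that by (simp add: sum.If_cases Int_def)
  have "(\<Sum>w\<in>neighbors G v. card {l \<in> L. graph_dist G w l = n}) =
      (\<Sum>l\<in>L. card {w \<in> neighbors G v. graph_dist G w l = n})"
    unfolding count[OF fin] count[OF finite_neighbors] by (rule sum.swap)
  also have "\<dots> = (\<Sum>l\<in>L. (if graph_dist G v l = Suc n then 1 else 0) +
      ?k * (if Suc (graph_dist G v l) = n then 1 else 0))"
    using L by (intro sum.cong refl, subst card_neighbors_at_dist[OF v]) auto
  also have "\<dots> = card {l \<in> L. graph_dist G v l = Suc n} +
      ?k * card {l \<in> L. Suc (graph_dist G v l) = n}"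
    unfolding count[OF fin] sum.distrib sum_distrib_left ..
  finally show ?thesis .
qed

section \<open>Distance counts under a balanced relation\<close>

text \<open>The induction is strong because the recursion looks one and two distances back; the pair
  stays arbitrary so that the hypothesis covers \<open>w\<close> and
  \<open>\<beta> w\<close>.\<close>

lemma balanced_card_at_dist_eq:
  assumes R: "R \<subseteq> pverts G \<times> pverts G" and bal: "balanced G R"
    and L: "L \<subseteq> pverts G" "\<And>c d. (c, d) \<in> R \<Longrightarrow> c \<in> L \<longleftrightarrow> d \<in> L"
    and "(c, d) \<in> R"
  shows "card {l \<in> L. graph_dist G c l = n} = card {l \<in> L. graph_dist G d l = n}"
  using assms(5)
proof (induction n arbitrary: c d rule: less_induct)
  case (less n)
  have cd: "c \<in> pverts G" "d \<in> pverts G"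
    using less.prems R by auto
  show ?case
  proof (cases n)
    case 0
    \<comment> \<open>At distance 0 the count merely tests membership in \<open>L\<close>, which
      \<open>R\<close> respects.\<close>
    have "{l \<in> L. graph_dist G x l = 0} = (if x \<in> L then {x} else {})" if "x \<in> pverts G" for x
      using that L(1) graph_dist_eq_0_iff by auto
    then show ?thesis
      using 0 cd L(2)[OF less.prems] by simp
  next
    case (Suc m)
    let ?N = "\<lambda>k x. card {l \<in> L. graph_dist G x l = k}"
    let ?B = "\<lambda>x. (if m = 1 then card (neighbors G x) else card (neighbors G x) - 1) *
      card {l \<in> L. Suc (graph_dist G x l) = m}"
    obtain \<beta> where \<beta>: "bij_betw \<beta> (neighbors G c) (neighbors G d)"
        "\<And>w. w \<in> neighbors G c \<Longrightarrow> (w, \<beta> w) \<in> R"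
      using bal less.prems unfolding balanced_def by blast
    have "(\<Sum>w\<in>neighbors G c. ?N m w) = (\<Sum>w\<in>neighbors G c. ?N m (\<beta> w))"
      using less.IH[of m] \<beta>(2) Suc by (intro sum.cong) auto
    also have "\<dots> = (\<Sum>w\<in>neighbors G d. ?N m w)"
      using \<beta>(1) by (rule sum.reindex_bij_betw)
    finally have "?N n c + ?B c = ?N n d + ?B d"
      using sum_neighbors_card_at_dist[OF _ L(1)] cd Suc by simp
    \<comment> \<open>For \<open>m = 0\<close> both sets are empty; otherwise these are the counts
      at distance \<open>m - 1\<close>.\<close>
    moreover have "card {l \<in> L. Suc (graph_dist G c l) = m} =
        card {l \<in> L. Suc (graph_dist G d l) = m}"
      using less.IH[of "m - 1"] less.prems Suc by (cases m) auto
    then have "?B c = ?B d"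
      using bij_betw_same_card[OF \<beta>(1)] by simp
    ultimately show ?thesis by simp
  qed
qed

end

theorem proposition3p1:
  fixes G :: "'a pair_pre_digraph" and R :: "'a rel" and c d :: 'a
  assumes "undirected_tree G"
    and "c \<in> pverts G" and "d \<in> pverts G"
    and "equiv (pverts G) R"
    and "balanced G R"
    and "\<not> trivial_equiv G R"
    and "(c, d) \<in> R"
  shows "leaf_dists G c = leaf_dists G d"
proof (rule multiset_eqI)
  fix n
  interpret undirected_tree G by fact
  have R: "R \<subseteq> pverts G \<times> pverts G"
    using assms(4) by (rule equiv_type)
  have L: "leaves G \<subseteq> pverts G"
    by (auto simp: leaves_def)
  have fin: "finite (leaves G)"
    using L pair_finite_verts by (rule finite_subset)
  \<comment> \<open>The bijections of a balanced relation preserve degrees, so the leaves form a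
    union of classes.\<close>
  have "x \<in> leaves G \<longleftrightarrow> y \<in> leaves G" if "(x, y) \<in> R" for x y
  proof -
    have "card (neighbors G x) = card (neighbors G y)"
      using assms(5) that bij_betw_same_card unfolding balanced_def by blast
    then show ?thesis
      using that R by (auto simp: leaves_def out_degree_eq_card_neighbors)
  qed
  then have "card {l \<in> leaves G. graph_dist G c l = n} = card {l \<in> leaves G. graph_dist G d l = n}"
    using balanced_card_at_dist_eq[OF R assms(5) L _ assms(7)] by blast
  moreover have "count (leaf_dists G x) n = card {l \<in> leaves G. graph_dist G x l = n}" for x
    using fin by (simp add: leaf_dists_def count_image_mset vimage_def Int_def conj_commute)
  ultimately show "count (leaf_dists G c) n = count (leaf_dists G d) n"
    by simp
qed

end
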